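(* Let $\Sigma$ be an alphabet with $|\Sigma|\ge2$ and let $\mathcal A=\langle\Sigma^*;\cdot\rangle$ be the free monoid on $\Sigma$ with concatenation. Let $f\colon\Sigma^*\to\Sigma^*$. 1) $f$ is congruence preserving if and only if $f$ preserves all $\mathcal A$-stable preorders. 2) If $f$ is congruence preserving, then for every $\mathcal A$-recognizable $L\subseteq\Sigma^*$ one has $f^{-1}(L)\in\mathfrak L_{\mathcal A}(L)$, and for every $L\subseteq\Sigma^*$ one has $f^{-1}(L)\in\mathfrak L^\infty_{\mathcal A}(L)$.
   Context: A preorder is a reflexive transitive relation. A binary relation $\rho$ on $\Sigma^*$ is $\mathcal A$-stable if $x\rho y$ and $x'\rho y'$ imply $(xx')\,\rho\,(yy')$. An $\mathcal A$-congruence is a stable equivalence relation. A function $f\colon\Sigma^*\to\Sigma^*$ preserves $\rho$ if $x\rho y$ implies $f(x)\rho f(y)$; it is congruence preserving if it preserves every $\mathcal A$-congruence. $L\subseteq\Sigma^*$ is $\mathcal A$-recognizable if there are a finite algebra $\langle M;\oplus\rangle$ with one binary operation and a surjective morphism $\varphi\colon\langle\Sigma^*;\cdot\rangle\to\langle M;\oplus\rangle$ with $L=\varphi^{-1}(\varphi(L))$. A (bounded) lattice of subsets of $\Sigma^*$ is a family of subsets containing $\Sigma^*$ and $\emptyset$ and closed under binary unions and intersections; it is complete if closed under arbitrary unions and intersections. $\mathfrak L_{\mathcal A}(L)$ (resp. $\mathfrak L^\infty_{\mathcal A}(L)$) is the smallest bounded lattice (resp. complete lattice) of subsets of $\Sigma^*$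 which contains $L$ and is closed under the maps $X\mapsto u^{-1}Xv^{-1}=\{x\mid uxv\in X\}$ for all $u,v\in\Sigma^*$. *)

theory Defs
  imports Main
begin

text \<open>
  The free monoid over an alphabet is the type \<open>'a list\<close> with concatenation \<open>@\<close>; the alphabet is
  the type \<open>'a\<close>, which may be infinite.
\<close>

definition stable :: "('a list \<Rightarrow> 'a list \<Rightarrow> bool) \<Rightarrow> bool" where
  "stable \<rho> \<longleftrightarrow> (\<forall>x y x' y'. \<rho> x y \<longrightarrow> \<rho> x' y' \<longrightarrow> \<rho> (x @ x') (y @ y'))"

definition stable_preorder :: "('a list \<Rightarrow> 'a list \<Rightarrow> bool) \<Rightarrow> bool" where
  "stable_preorder \<rho> \<longleftrightarrow> reflp \<rho> \<and> transp \<rho> \<and> stable \<rho>"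

definition congruence :: "('a list \<Rightarrow> 'a list \<Rightarrow> bool) \<Rightarrow> bool" where
  "congruence \<rho> \<longleftrightarrow> equivp \<rho> \<and> stable \<rho>"

definition preserves :: "('a list \<Rightarrow> 'a list) \<Rightarrow> ('a list \<Rightarrow> 'a list \<Rightarrow> bool) \<Rightarrow> bool" where
  "preserves f \<rho> \<longleftrightarrow> (\<forall>x y. \<rho> x y \<longrightarrow> \<rho> (f x) (f y))"

definition congruence_preserving :: "('a list \<Rightarrow> 'a list) \<Rightarrow> bool" where
  "congruence_preserving f \<longleftrightarrow> (\<forall>\<rho>. congruence \<rho> \<longrightarrow> preserves f \<rho>)"

definition recognized_by ::
    "'m set \<Rightarrow> ('m \<Rightarrow> 'm \<Rightarrow> 'm) \<Rightarrow> ('a list \<Rightarrow> 'm) \<Rightarrow> 'a list set \<Rightarrow> bool" where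
  "recognized_by M m \<phi> L \<longleftrightarrow>
     finite M \<and> (\<forall>a\<in>M. \<forall>b\<in>M. m a b \<in> M) \<and>
     range \<phi> = M \<and> (\<forall>x y. \<phi> (x @ y) = m (\<phi> x) (\<phi> y)) \<and>
     L = \<phi> -` (\<phi> ` L)"

text \<open>
  HOL cannot quantify existentially over types, so the finite algebra is taken with a carrier
  consisting of natural numbers.  This loses nothing: lemma \<open>recognized_by_imp_recognizable\<close> shows
  that a finite algebra on a carrier of any type will do.
\<close>

definition recognizable :: "'a list set \<Rightarrow> bool" where
  "recognizable L \<longleftrightarrow>
     (\<exists>(M :: nat set) (m :: nat \<Rightarrow> nat \<Rightarrow> nat) (\<phi> :: 'a list \<Rightarrow> nat). recognized_by M m \<phi> L)"

lemma recognized_by_imp_recognizable: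
  fixes M :: "'m set"
  assumes "recognized_by M m \<phi> L"
  shows "recognizable L"
proof -
  have fin: "finite M" and cl: "\<And>a b. a \<in> M \<Longrightarrow> b \<in> M \<Longrightarrow> m a b \<in> M"
    and ran: "range \<phi> = M" and hom: "\<And>x y. \<phi> (x @ y) = m (\<phi> x) (\<phi> y)"
    and L: "L = \<phi> -` (\<phi> ` L)"
    using assms unfolding recognized_by_def by blast+
  obtain e :: "'m \<Rightarrow> nat" where inj: "inj_on e M"
    using finite_imp_inj_to_nat_seg[OF fin] by blast
  define d where "d = the_inv_into M e"
  have d: "d (e a) = a" if "a \<in> M" for a
    using that inj by (simp add: d_def the_inv_into_f_f)
  have in_M: "\<phi> x \<in> M" for x
    using ran by blast
  have "x \<in> L" if "e (\<phi> x) = e (\<phi> y)" "y \<in> L" for x y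
  proof -
    have "\<phi> x = \<phi> y"
      using that(1) inj in_M by (simp add: inj_on_eq_iff)
    then have "x \<in> \<phi> -` (\<phi> ` L)"
      using that(2) by simp
    then show ?thesis
      using L by simp
  qed
  then have "L = (e \<circ> \<phi>) -` ((e \<circ> \<phi>) ` L)"
    by auto
  moreover have "range (e \<circ> \<phi>) = e ` M"
    using ran by (metis image_comp)
  ultimately have "recognized_by (e ` M) (\<lambda>a b. e (m (d a) (d b))) (e \<circ> \<phi>) L"
    unfolding recognized_by_def using fin cl hom d in_M by auto
  then show ?thesis
    unfolding recognizable_def by blast
qed

definition residual :: "'a list \<Rightarrow> 'a list \<Rightarrow> 'a list set \<Rightarrow> 'a list set" where
  "residual u v X = {x. u @ x @ v \<in> X}"

definition residual_closed :: "'a list set set \<Rightarrow> bool" where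
  "residual_closed F \<longleftrightarrow> (\<forall>u v. \<forall>X\<in>F. residual u v X \<in> F)"

definition bounded_set_lattice :: "'a list set set \<Rightarrow> bool" where
  "bounded_set_lattice F \<longleftrightarrow>
     UNIV \<in> F \<and> {} \<in> F \<and> (\<forall>X\<in>F. \<forall>Y\<in>F. X \<union> Y \<in> F \<and> X \<inter> Y \<in> F)"

definition complete_set_lattice :: "'a list set set \<Rightarrow> bool" where
  "complete_set_lattice F \<longleftrightarrow>
     bounded_set_lattice F \<and> (\<forall>G\<subseteq>F. \<Union>G \<in> F \<and> \<Inter>G \<in> F)"

definition residual_lattice :: "'a list set \<Rightarrow> 'a list set set" where
  "residual_lattice L = \<Inter>{F. bounded_set_lattice F \<and> residual_closed F \<and> L \<in> F}"

definition complete_residual_lattice :: "'a list set \<Rightarrow> 'a list set set" where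
  "complete_residual_lattice L = \<Inter>{F. complete_set_lattice F \<and> residual_closed F \<and> L \<in> F}"

text \<open>The two intersections are themselves lattices of the required kind, hence the smallest ones.\<close>

lemma residual_lattice_is_least:
  "bounded_set_lattice (residual_lattice L)" "residual_closed (residual_lattice L)"
  "L \<in> residual_lattice L"
  "\<lbrakk>bounded_set_lattice F; residual_closed F; L \<in> F\<rbrakk> \<Longrightarrow> residual_lattice L \<subseteq> F"
  unfolding residual_lattice_def bounded_set_lattice_def residual_closed_def by auto

lemma complete_residual_lattice_is_least:
  "complete_set_lattice (complete_residual_lattice L)"
  "residual_closed (complete_residual_lattice L)"
  "L \<in> complete_residual_lattice L"
  "\<lbrakk>complete_set_lattice F; residual_closed F; L \<in> F\<rbrakk> \<Longrightarrow> complete_residual_lattice L \<subseteq> F"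
proof -
  show "complete_set_lattice (complete_residual_lattice L)"
    unfolding complete_set_lattice_def
  proof (intro conjI allI impI)
    show "bounded_set_lattice (complete_residual_lattice L)"
      unfolding complete_residual_lattice_def complete_set_lattice_def bounded_set_lattice_def
      by auto
  next
    fix G assume G: "G \<subseteq> complete_residual_lattice L"
    have "G \<subseteq> F" if "complete_set_lattice F" "residual_closed F" "L \<in> F" for F
      using G that unfolding complete_residual_lattice_def by blast
    then show "\<Union>G \<in> complete_residual_lattice L" "\<Inter>G \<in> complete_residual_lattice L"
      unfolding complete_residual_lattice_def complete_set_lattice_def by simp_all
  qed
qed (auto simp: complete_residual_lattice_def residual_closed_def)

end

theory Submission
  imports Defs "HOL-Library.Sublist"
begin

text \<open>
  The key fact is that a congruence preserving \<open>f\<close> agrees, on every finite set of words, with a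
  polynomial \<open>y \<mapsto> w\<^sub>0 y w\<^sub>1 y \<dots> y w\<^sub>k\<close> (lemma \<open>congruence_preserving_imp_polynomial_on_finite\<close>).
  A polynomial preserves every stable preorder, and preservation involves only two words at a
  time, so part 1 follows.

  To find the polynomial, take distinct letters \<open>a\<close>, \<open>b\<close> and compare \<open>f\<close> at three kinds of words:
  the short word \<open>z = aabb\<close>, a very long word \<open>x = aabab\<^sup>n\<close>, and the given words \<open>y\<close>.  Occurrences
  of \<open>x\<close> overlap neither each other nor occurrences of \<open>z\<close>.  Hence replacing every \<open>x\<close> by \<open>z\<close> is a
  well-defined operation whose kernel contains a congruence identifying \<open>x\<close> and \<open>z\<close>.  As \<open>f z\<close> is
  too short to contain \<open>x\<close>, it is obtained from \<open>f x\<close> by this replacement: for some polynomial \<open>P\<close>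
  one has \<open>f x = P x\<close> and \<open>f z = P z\<close>.  The second equation bounds the size of \<open>P\<close>
  independently of \<open>n\<close>.

  For an arbitrary \<open>y\<close>, overlaps between \<open>x\<close> and \<open>y\<close> cannot be avoided, but the rewriting rule
  \<open>x \<rightarrow> y\<close> is still length-decreasing and confluent, because \<open>x\<close> does not overlap itself.  So two
  words that are identified by the congruence generated by \<open>x \<sim> y\<close> and do not contain \<open>x\<close> are equal.
  This applies to \<open>f y\<close> and \<open>P y\<close>: they are congruent since \<open>f y \<sim> f x = P x \<sim> P y\<close>, and
  by the bound on \<open>P\<close> both are shorter than \<open>x\<close> once \<open>n\<close> is large.

  For part 2, \<open>f\<close> preserves the syntactic preorder of \<open>L\<close>, so \<open>f\<^sup>-\<^sup>1(L)\<close> is an up-set of it.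
  Principal up-sets are intersections of residuals of \<open>L\<close>, and an up-set is a union of
  principal ones; when \<open>L\<close> is recognizable only finitely many residuals exist.
\<close>

section \<open>Polynomials\<close>

text \<open>
  A polynomial in one variable over the free monoid is a word over the alphabet extended by
  a letter \<^term>\<open>None\<close> that stands for the variable.
\<close>

definition subst :: "'a list \<Rightarrow> 'a option list \<Rightarrow> 'a list" where
  "subst x P = concat (map (case_option x (\<lambda>c. [c])) P)"

lemma subst_simps [simp]:
  "subst x [] = []"
  "subst x (None # P) = x @ subst x P"
  "subst x (Some c # P) = c # subst x P"
  by (simp_all add: subst_def)

lemma stable_preorder_subst:
  assumes "stable_preorder \<rho>" "\<rho> x y"
  shows "\<rho> (subst x P) (subst y P)"
proof (induction P)
  case Nil
  then show ?case
    using assms(1) by (simp add: stable_preorder_def reflpD)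
next
  case (Cons l P)
  have "\<rho> (case_option x (\<lambda>c. [c]) l) (case_option y (\<lambda>c. [c]) l)"
    using assms by (auto simp: stable_preorder_def reflpD split: option.split)
  with Cons show ?case
    using assms(1) by (simp add: subst_def stable_preorder_def stable_def)
qed

lemma length_subst_le: "length (subst x P) \<le> length P * (length x + 1)"
proof (induction P)
  case (Cons l P)
  then show ?case by (cases l) auto
qed simp

lemma length_le_length_subst:
  assumes "x \<noteq> []"
  shows "length P \<le> length (subst x P)"
proof (induction P)
  case (Cons l P)
  moreover have "length x \<ge> 1"
    using assms by (simp add: Suc_leI)
  ultimately show ?case by (cases l) auto
qed simp

section \<open>Congruences from functions\<close>

text \<open>
  Any function \<open>h\<close> on words induces a syntactic congruence, the largest congruence contained in
  the kernel of \<open>h\<close>.  To use it on the pair \<open>x\<close>, \<open>y\<close> one needs only that \<open>h\<close> does not distinguish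
  \<open>x\<close> from \<open>y\<close> in any context.
\<close>

lemma congruence_preserving_invariant:
  assumes f: "congruence_preserving f"
    and h: "\<And>u v. h (u @ x @ v) = h (u @ y @ v)"
  shows "h (f x) = h (f y)"
proof -
  define \<rho> where "\<rho> s t \<longleftrightarrow> (\<forall>u v. h (u @ s @ v) = h (u @ t @ v))" for s t
  have "\<rho> (s @ s') (t @ t')" if "\<rho> s t" "\<rho> s' t'" for s s' t t'
    using that unfolding \<rho>_def by (metis append.assoc)
  moreover have "equivp \<rho>"
    by (rule equivpI) (auto simp: \<rho>_def reflp_def symp_def transp_def)
  ultimately have "congruence \<rho>"
    by (auto simp: congruence_def stable_def)
  moreover have "\<rho> x y"
    by (simp add: \<rho>_def h)
  ultimately have "\<rho> (f x) (f y)"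
    using f unfolding congruence_preserving_def preserves_def by blast
  then have "h ([] @ f x @ []) = h ([] @ f y @ [])"
    unfolding \<rho>_def by blast
  then show ?thesis by simp
qed

text \<open>
  With \<open>y = x\<close> the following property says that \<open>x\<close> is unbordered.  The case \<open>u = []\<close> is
  exempted because of this use, where \<open>x\<close> itself is a prefix of \<open>x @ v\<close>.
\<close>

definition clear_of :: "'a list \<Rightarrow> 'a list \<Rightarrow> bool" where
  "clear_of x y \<longleftrightarrow> (\<forall>u v. prefix x (u @ y @ v) \<longrightarrow> u = [] \<or> prefix x u)"

section \<open>Confluent reduction by a single unbordered word\<close>

text \<open>
  The occurrence to be replaced is chosen arbitrarily; for unbordered \<open>x\<close> the result turns out
  not to depend on this choice.  The guard on the lengths makes the recursion terminate.
\<close>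

function reduce :: "'a list \<Rightarrow> 'a list \<Rightarrow> 'a list \<Rightarrow> 'a list" where
  "reduce x y w =
    (if length y < length x \<and> sublist x w
     then (let p = (SOME p. w = fst p @ x @ snd p) in reduce x y (fst p @ y @ snd p))
     else w)"
  by pat_completeness auto
termination
proof (relation "measure (\<lambda>(x, y, w). length w)", goal_cases)
  case (2 x y w p)
  then have "\<exists>p. w = fst p @ x @ snd p"
    by (auto simp: sublist_def)
  then have "w = fst p @ x @ snd p"
    unfolding \<open>p = _\<close> by (rule someI_ex)
  then have "length w = length (fst p @ x @ snd p)"
    by (rule arg_cong)
  then show ?case
    using 2 by simp
qed simp

declare reduce.simps [simp del]

lemma reduce_irreducible: "length w < length x \<Longrightarrow> reduce x y w = w"
  by (subst reduce.simps) (auto dest: sublist_length_le)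

lemma reduce_some_occurrence:
  assumes "length y < length x" "sublist x w"
  obtains p q where "w = p @ x @ q" "reduce x y w = reduce x y (p @ y @ q)"
proof -
  define r where "r = (SOME p. w = fst p @ x @ snd p)"
  have "\<exists>p. w = fst p @ x @ snd p"
    using assms(2) by (auto simp: sublist_def)
  then have "w = fst r @ x @ snd r"
    unfolding r_def by (rule someI_ex)
  moreover have "reduce x y w = reduce x y (fst r @ y @ snd r)"
    using assms by (subst reduce.simps) (simp add: r_def Let_def)
  ultimately show thesis
    by (rule that)
qed

text \<open>
  Confluence: two different occurrences of an unbordered word are disjoint, so replacing one of
  them leaves the other intact, and both orders of replacement lead to a common word.
\<close>

lemma reduce_occurrence:
  assumes len: "length y < length x" and unb: "clear_of x x"
  shows "reduce x y (u @ x @ v) = reduce x y (u @ y @ v)"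
proof (induction "length u + length v" arbitrary: u v rule: less_induct)
  case less
  have disjoint: "reduce x y (p @ y @ m @ x @ q) = reduce x y (p @ x @ m @ y @ q)"
    if "length p + length x + length m + length q = length u + length v" for p m q
  proof -
    have "reduce x y ((p @ y @ m) @ x @ q) = reduce x y ((p @ y @ m) @ y @ q)"
      by (rule less) (use that len in simp)
    also have "\<dots> = reduce x y (p @ y @ (m @ y @ q))"
      by simp
    also have "\<dots> = reduce x y (p @ x @ (m @ y @ q))"
      by (rule less[symmetric]) (use that len in simp)
    finally show ?thesis by simp
  qed
  have "sublist x (u @ x @ v)"
    by (auto simp: sublist_def)
  with len obtain p q where eq: "u @ x @ v = p @ x @ q"
    and red: "reduce x y (u @ x @ v) = reduce x y (p @ y @ q)"
    by (rule reduce_some_occurrence)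
  from eq consider m where "u = p @ m" "m @ x @ v = x @ q"
    | m where "p = u @ m" "x @ v = m @ x @ q"
    using append_eq_append_conv2[of u "x @ v" p "x @ q"] by metis
  then show ?case
  proof cases
    case 1
    then have "m = [] \<or> prefix x m"
      using unb unfolding clear_of_def by (metis prefixI)
    then consider "m = []" | m' where "m = x @ m'"
      by (auto elim: prefixE)
    then show ?thesis
    proof cases
      case 1
      then show ?thesis
        using red \<open>u = p @ m\<close> \<open>m @ x @ v = x @ q\<close> by simp
    next
      case (2 m')
      then have "q = m' @ x @ v"
        using \<open>m @ x @ v = x @ q\<close> by simp
      then show ?thesis
        using red \<open>u = p @ m\<close> 2 disjoint[of p m' v] by simp
    qed
  next
    case 2
    then have "m = [] \<or> prefix x m"
      using unb unfolding clear_of_def by (metis prefixI)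
    then consider "m = []" | m' where "m = x @ m'"
      by (auto elim: prefixE)
    then show ?thesis
    proof cases
      case 1
      then show ?thesis
        using red \<open>p = u @ m\<close> \<open>x @ v = m @ x @ q\<close> by simp
    next
      case (2 m')
      then have "v = m' @ x @ q"
        using \<open>x @ v = m @ x @ q\<close> by simp
      then show ?thesis
        using red \<open>p = u @ m\<close> 2 disjoint[of u m' q] by simp
    qed
  qed
qed

lemma reduce_subst:
  assumes "length y < length x" "clear_of x x"
  shows "reduce x y (u @ subst x P) = reduce x y (u @ subst y P)"
proof (induction P arbitrary: u)
  case (Cons l P)
  show ?case
  proof (cases l)
    case None
    have "reduce x y ((u @ x) @ subst x P) = reduce x y ((u @ x) @ subst y P)"
      by (rule Cons)
    then show ?thesis
      using None reduce_occurrence[OF assms] by simp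
  next
    case (Some c)
    then show ?thesis
      using Cons[of "u @ [c]"] by simp
  qed
qed simp

section \<open>Left-to-right replacement\<close>

text \<open>
  The polynomial obtained by scanning \<open>w\<close> from the left and putting the variable for every
  occurrence of \<open>x\<close> that is met.  The guard \<open>x \<noteq> []\<close> makes the recursion terminate.
\<close>

function mark :: "'a list \<Rightarrow> 'a list \<Rightarrow> 'a option list" where
  "mark x w =
    (if w = [] then []
     else if x \<noteq> [] \<and> prefix x w then None # mark x (drop (length x) w)
     else Some (hd w) # mark x (tl w))"
  by pat_completeness auto
termination
  by (relation "measure (\<lambda>(x, w). length w)") auto

declare mark.simps [simp del]

lemma mark_Nil [simp]: "mark x [] = []"
  by (simp add: mark.simps)

lemma mark_occurrence: "x \<noteq> [] \<Longrightarrow> mark x (x @ w) = None # mark x w"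
  by (subst mark.simps) simp

lemma mark_Cons: "\<not> prefix x (c # w) \<Longrightarrow> mark x (c # w) = Some c # mark x w"
  by (subst mark.simps) simp

lemma subst_mark: "subst x (mark x w) = w"
proof (induction w rule: length_induct)
  case (1 w)
  show ?case
  proof (cases "w = []")
    case False
    show ?thesis
    proof (cases "x \<noteq> [] \<and> prefix x w")
      case True
      then obtain w' where "w = x @ w'" by (auto elim: prefixE)
      then show ?thesis using True 1 by (simp add: mark_occurrence)
    next
      case no: False
      then have "mark x w = Some (hd w) # mark x (tl w)"
        using False by (subst mark.simps) simp
      then show ?thesis using False 1 by simp
    qed
  qed simp
qed

lemma mark_short: "length w < length x \<Longrightarrow> subst z (mark x w) = w"
proof (induction w)
  case (Cons c w)
  then have "\<not> prefix x (c # w)"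
    by (auto dest: prefix_length_le)
  then show ?case using Cons by (simp add: mark_Cons)
qed simp

text \<open>
  Scanning through \<open>u\<close> proceeds in the same way whether \<open>u\<close> is followed by \<open>x\<close> or by \<open>z\<close>, as no
  occurrence of \<open>x\<close> straddles the boundary.  The last assumption is satisfied when the scan then
  passes over \<open>z\<close> without meeting an occurrence of \<open>x\<close> that begins inside \<open>z\<close>.
\<close>

lemma subst_mark_occurrence:
  assumes "x \<noteq> []" and clear: "clear_of x x" "clear_of x z"
    and z: "\<And>v. subst z (mark x (z @ v)) = z @ subst z (mark x v)"
  shows "subst z (mark x (u @ x @ v)) = subst z (mark x (u @ z @ v))"
proof (induction u rule: length_induct)
  case (1 u)
  show ?case
  proof (cases u)
    case Nil
    then show ?thesis
      using assms(1) z by (simp add: mark_occurrence)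
  next
    case (Cons c u')
    show ?thesis
    proof (cases "prefix x u")
      case True
      then obtain u'' where u: "u = x @ u''" by (auto elim: prefixE)
      then have "subst z (mark x (u'' @ x @ v)) = subst z (mark x (u'' @ z @ v))"
        using 1 assms(1) by simp
      then show ?thesis
        using assms(1) u by (simp add: mark_occurrence)
    next
      case False
      then have "\<not> prefix x (u @ x @ v)" "\<not> prefix x (u @ z @ v)"
        using clear Cons unfolding clear_of_def by blast+
      then show ?thesis
        using 1 Cons by (simp add: mark_Cons)
    qed
  qed
qed

section \<open>A suitable family of unbordered words\<close>

abbreviation probe :: "'a \<Rightarrow> 'a \<Rightarrow> nat \<Rightarrow> 'a list" where
  "probe a b n \<equiv> a # a # b # a # replicate (Suc n) b"

lemma prefix_replicate_append_Cons:
  assumes "a \<noteq> b" "prefix (replicate k b) (u @ a # w)"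
  shows "prefix (replicate k b) u"
  using assms(2)
proof (induction k arbitrary: u)
  case (Suc k)
  show ?case
  proof (cases u)
    case Nil
    then show ?thesis
      using Suc.prems assms(1) by simp
  next
    case (Cons c u')
    then have c: "b = c" and "prefix (replicate k b) (u' @ a # w)"
      using Suc.prems by auto
    from this(2) have "prefix (replicate k b) u'"
      by (rule Suc.IH)
    then show ?thesis
      using Cons c by simp
  qed
qed simp

text \<open>
  The factor \<open>aab\<close> occurs in the probe \<open>aabab\<^sup>n\<^sup>+\<^sup>1\<close> only at its beginning, and no proper nonempty
  suffix of the probe is a prefix of \<open>aab\<close>.
\<close>

lemma clear_of_probe:
  assumes "a \<noteq> b"
  shows "clear_of (probe a b n) (a # a # b # t)"
  unfolding clear_of_def
proof (intro allI impI)
  fix u v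
  assume pre: "prefix (probe a b n) (u @ (a # a # b # t) @ v)"
  consider "u = []" | c where "u = [c]" | c d where "u = [c, d]" | c d e where "u = [c, d, e]"
    | c d e g u' where "u = c # d # e # g # u'"
    by (cases u; cases "tl u"; cases "tl (tl u)"; cases "tl (tl (tl u))"; simp)
  then show "u = [] \<or> prefix (probe a b n) u"
  proof cases
    case (5 c d e g u')
    then have "prefix (replicate (Suc n) b) (u' @ a # a # b # t @ v)"
      using pre by (auto simp del: replicate_Suc)
    then have "prefix (replicate (Suc n) b) u'"
      by (rule prefix_replicate_append_Cons[OF assms])
    then show ?thesis
      using pre 5 by (auto simp del: replicate_Suc)
  qed (use pre assms in simp_all)
qed

lemma mark_probe_aabb:
  assumes "a \<noteq> b"
  shows "subst z (mark (probe a b n) ([a, a, b, b] @ v))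
    = [a, a, b, b] @ subst z (mark (probe a b n) v)"
  using assms by (simp add: mark_Cons)

section \<open>Congruence preserving functions are locally polynomial\<close>

lemma congruence_preserving_imp_polynomial_on_finite:
  fixes f :: "'a list \<Rightarrow> 'a list"
  assumes letters: "\<exists>a b :: 'a. a \<noteq> b"
    and f: "congruence_preserving f" and "finite Y"
  shows "\<exists>P. \<forall>y\<in>Y. f y = subst y P"
proof -
  obtain a b :: 'a where ab: "a \<noteq> b"
    using letters by blast
  let ?z = "[a, a, b, b]"
  \<comment> \<open>a bound, independent of the probe, on all words that must not contain it\<close>
  define n where "n = length (f ?z)
    + (\<Sum>y\<in>Y. length y + length (f y) + length (f ?z) * (length y + 1))"
  let ?x = "probe a b n"
  have large: "length y \<le> n \<and> length (f y) \<le> n \<and> length (f ?z) * (length y + 1) \<le> n"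
    if "y \<in> Y" for y
    using member_le_sum[OF that, of "\<lambda>y. length y + length (f y) + length (f ?z) * (length y + 1)"]
      \<open>finite Y\<close> by (simp add: n_def)
  define P where "P = mark ?x (f ?x)"
  have unb: "clear_of ?x ?x" and clear: "clear_of ?x ?z"
    using clear_of_probe[OF ab] by blast+
  have Px: "f ?x = subst ?x P"
    by (simp add: P_def subst_mark)
  have "subst ?z (mark ?x (f ?x)) = subst ?z (mark ?x (f ?z))"
    by (rule congruence_preserving_invariant[OF f],
        rule subst_mark_occurrence[OF _ unb clear mark_probe_aabb[OF ab]]) simp
  moreover have "subst ?z (mark ?x (f ?z)) = f ?z"
    by (rule mark_short) (simp add: n_def)
  ultimately have "subst ?z P = f ?z"
    by (simp add: P_def)
  then have P_le: "length P \<le> length (f ?z)"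
    using length_le_length_subst[of ?z P] by simp
  have "f y = subst y P" if "y \<in> Y" for y
  proof -
    have y: "length y < length ?x"
      using large[OF that] by simp
    have "length (subst y P) \<le> length P * (length y + 1)"
      by (rule length_subst_le)
    also have "\<dots> \<le> length (f ?z) * (length y + 1)"
      using P_le by (rule mult_le_mono1)
    also have "\<dots> < length ?x"
      using large[OF that] by simp
    finally have irreducible: "reduce ?x y (subst y P) = subst y P"
      by (rule reduce_irreducible)
    have "f y = reduce ?x y (f y)"
      using large[OF that] by (intro reduce_irreducible[symmetric]) simp
    also have "\<dots> = reduce ?x y (f ?x)"
      by (rule congruence_preserving_invariant[OF f, symmetric], rule reduce_occurrence[OF y unb])
    also have "\<dots> = reduce ?x y (subst y P)"
      using reduce_subst[OF y unb, of "[]" P] Px by simp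
    finally show ?thesis
      using irreducible by simp
  qed
  then show ?thesis by blast
qed

lemma congruence_preserving_iff_preserves_stable_preorders:
  fixes f :: "'a list \<Rightarrow> 'a list"
  assumes "\<exists>a b :: 'a. a \<noteq> b"
  shows "congruence_preserving f \<longleftrightarrow> (\<forall>\<rho>. stable_preorder \<rho> \<longrightarrow> preserves f \<rho>)"
proof (intro iffI allI impI)
  fix \<rho> :: "'a list \<Rightarrow> 'a list \<Rightarrow> bool"
  assume f: "congruence_preserving f" and \<rho>: "stable_preorder \<rho>"
  have "\<rho> (f x) (f y)" if "\<rho> x y" for x y
  proof -
    obtain P where "\<forall>w\<in>{x, y}. f w = subst w P"
      using congruence_preserving_imp_polynomial_on_finite[OF assms f, of "{x, y}"] by auto
    then show ?thesis
      using stable_preorder_subst[OF \<rho> that] by simp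
  qed
  then show "preserves f \<rho>"
    by (simp add: preserves_def)
next
  assume "\<forall>\<rho>. stable_preorder \<rho> \<longrightarrow> preserves f \<rho>"
  then show "congruence_preserving f"
    by (simp add: congruence_preserving_def congruence_def stable_preorder_def
        equivp_reflp_symp_transp)
qed

section \<open>Preimages in lattices of residuals\<close>

definition syntactic_preorder :: "'a list set \<Rightarrow> 'a list \<Rightarrow> 'a list \<Rightarrow> bool" where
  "syntactic_preorder L x y \<longleftrightarrow> (\<forall>u v. u @ x @ v \<in> L \<longrightarrow> u @ y @ v \<in> L)"

lemma stable_preorder_syntactic_preorder: "stable_preorder (syntactic_preorder L)"
proof -
  have "syntactic_preorder L (x @ x') (y @ y')"
    if "syntactic_preorder L x y" "syntactic_preorder L x' y'" for x x' y y'
    using that unfolding syntactic_preorder_def by (metis append.assoc)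
  then show ?thesis
    by (auto simp: stable_preorder_def stable_def reflp_def transp_def syntactic_preorder_def)
qed

definition residuals :: "'a list set \<Rightarrow> 'a list set set" where
  "residuals L = {residual u v L | u v. True}"

text \<open>
  For every \<open>x\<close>, the intersection of the residuals of \<open>L\<close> that contain \<open>x\<close> is the up-set generated
  by \<open>x\<close> in the syntactic preorder.
\<close>

lemma preimage_eq_Union_Inter_residuals:
  assumes "preserves f (syntactic_preorder L)"
  shows "f -` L = \<Union> ((\<lambda>x. \<Inter> {R \<in> residuals L. x \<in> R}) ` (f -` L))"
proof -
  have up: "y \<in> \<Inter> {R \<in> residuals L. x \<in> R} \<longleftrightarrow> syntactic_preorder L x y" for x y
    by (auto simp: residuals_def residual_def syntactic_preorder_def)
  have "f y \<in> L" if "f x \<in> L" "syntactic_preorder L x y" for x y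
  proof -
    have "syntactic_preorder L (f x) (f y)"
      using assms that(2) by (simp add: preserves_def)
    then have "[] @ f x @ [] \<in> L \<longrightarrow> [] @ f y @ [] \<in> L"
      unfolding syntactic_preorder_def by blast
    then show ?thesis using that(1) by simp
  qed
  moreover have "syntactic_preorder L x x" for x
    by (simp add: syntactic_preorder_def)
  ultimately show ?thesis
    unfolding set_eq_iff UN_iff up by auto
qed

lemma finite_residuals:
  assumes "recognizable L"
  shows "finite (residuals L)"
proof -
  obtain M :: "nat set" and m \<phi> where "recognized_by M m \<phi> L"
    using assms by (auto simp: recognizable_def)
  then have fin: "finite M" and ran: "range \<phi> = M"
    and hom: "\<And>x y. \<phi> (x @ y) = m (\<phi> x) (\<phi> y)" and L: "L = \<phi> -` (\<phi> ` L)"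
    by (auto simp: recognized_by_def)
  have saturated: "w \<in> L \<longleftrightarrow> \<phi> w \<in> \<phi> ` L" for w
    by (subst L) (rule vimage_eq)
  define R where "R p q = {x. m p (m (\<phi> x) q) \<in> \<phi> ` L}" for p q
  have "residual u v L = R (\<phi> u) (\<phi> v)" for u v
    unfolding residual_def R_def hom[symmetric] by (rule Collect_cong) (rule saturated)
  then have "residuals L \<subseteq> (\<lambda>(p, q). R p q) ` (M \<times> M)"
    unfolding residuals_def ran[symmetric] by auto
  then show ?thesis
    by (rule finite_subset) (use fin in simp)
qed

lemma bounded_set_lattice_finite_Inter:
  assumes "bounded_set_lattice F" "finite G" "G \<subseteq> F"
  shows "\<Inter> G \<in> F"
  using assms(2,3,1) by (induction G) (auto simp: bounded_set_lattice_def)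

lemma bounded_set_lattice_finite_Union:
  assumes "bounded_set_lattice F" "finite G" "G \<subseteq> F"
  shows "\<Union> G \<in> F"
  using assms(2,3,1) by (induction G) (auto simp: bounded_set_lattice_def)

lemma preimage_in_residual_lattice:
  assumes f: "preserves f (syntactic_preorder L)" and L: "recognizable L"
  shows "f -` L \<in> residual_lattice L"
proof -
  note lattice = residual_lattice_is_least(1-3)[of L]
  let ?up = "\<lambda>x. \<Inter> {R \<in> residuals L. x \<in> R}"
  have res: "residuals L \<subseteq> residual_lattice L"
    using lattice(2,3) by (auto simp: residuals_def residual_closed_def)
  have "?up x \<in> residual_lattice L" for x
    by (rule bounded_set_lattice_finite_Inter[OF lattice(1)])
      (use res finite_residuals[OF L] in auto)
  moreover have "finite (?up ` (f -` L))"
  proof (rule finite_subset)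
    show "?up ` (f -` L) \<subseteq> Inter ` Pow (residuals L)" by auto
  qed (use finite_residuals[OF L] in simp)
  ultimately have "\<Union> (?up ` (f -` L)) \<in> residual_lattice L"
    by (intro bounded_set_lattice_finite_Union[OF lattice(1)]) auto
  then show ?thesis
    using preimage_eq_Union_Inter_residuals[OF f] by simp
qed

lemma preimage_in_complete_residual_lattice:
  assumes f: "preserves f (syntactic_preorder L)"
  shows "f -` L \<in> complete_residual_lattice L"
proof -
  note lattice = complete_residual_lattice_is_least(1-3)[of L]
  let ?up = "\<lambda>x. \<Inter> {R \<in> residuals L. x \<in> R}"
  have closed: "\<Union> G \<in> complete_residual_lattice L \<and> \<Inter> G \<in> complete_residual_lattice L"
    if "G \<subseteq> complete_residual_lattice L" for G
    using lattice(1) that by (simp add: complete_set_lattice_def)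
  have "residuals L \<subseteq> complete_residual_lattice L"
    using lattice(2,3) by (auto simp: residuals_def residual_closed_def)
  then have "?up x \<in> complete_residual_lattice L" for x
    using closed[of "{R \<in> residuals L. x \<in> R}"] by blast
  then have "\<Union> (?up ` (f -` L)) \<in> complete_residual_lattice L"
    using closed[of "?up ` (f -` L)"] by blast
  then show ?thesis
    using preimage_eq_Union_Inter_residuals[OF f] by simp
qed

theorem theorem3p4:
  fixes f :: "'a list \<Rightarrow> 'a list"
  assumes "\<exists>a b :: 'a. a \<noteq> b"
  shows "(congruence_preserving f \<longleftrightarrow> (\<forall>\<rho>. stable_preorder \<rho> \<longrightarrow> preserves f \<rho>))
    \<and> (congruence_preserving f \<longrightarrow>
        (\<forall>L. recognizable L \<longrightarrow> f -` L \<in> residual_lattice L) \<and>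
        (\<forall>L. f -` L \<in> complete_residual_lattice L))"
  using congruence_preserving_iff_preserves_stable_preorders[OF assms, of f]
    stable_preorder_syntactic_preorder preimage_in_residual_lattice
    preimage_in_complete_residual_lattice
  by blast

end
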